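(* Let $L$ and $L'$ be oriented links. If $\Phi^{(A^{(5)},B^{(5)})}_{X_2}(L)=\Phi^{(A^{(5)},B^{(5)})}_{X_2}(L')$, then $J(L)=J(L')$.
   Context: $J(L)$ is the Jones polynomial of the oriented link $L$ normalized so that the trivial knot $O$ has $J(O)=-t^{1/2}-t^{-1/2}$. Colorings: $X_2=\mathbb{Z}/2\mathbb{Z}$ with $[a,b,c]=a+b-c$. Let $D$ be a diagram of an oriented link; regions are the components of $\mathbb{R}^2\setminus D$. Rotate a crossing $c$ so that both strands point downward; let the left, top, bottom, right regions have colors $W,N,S,E$. Put $(x_c,y_c,z_c)=(W,N,S)$ if $c$ is positive and $(W,S,N)$ if $c$ is negative. A map $C$ from the regions to $X_2$ is an $X_2$-coloring if $E=[x_c,y_c,z_c]$ at every crossing; $\mathrm{cl}_C(c)=(x_c,y_c,z_c)$; $\mathrm{Col}_{X_2}(D)$ is the set of $X_2$-colorings. The maps $A^{(5)},B^{(5)}:X_2^3\to\mathbb{Z}[x_1^{\pm1},\dots,x_5^{\pm1}]$ are: $A^{(5)}_{0,0,0}=A^{(5)}_{0,1,1}=A^{(5)}_{1,0,0}=A^{(5)}_{1,1,1}=x_1$, $A^{(5)}_{0,0,1}=x_2$, $A^{(5)}_{0,1,0}=x_3$, $A^{(5)}_{1,0,1}=x_4$, $A^{(5)}_{1,1,0}=x_2x_3x_4^{-1}$; and $B^{(5)}_{a,b,c}=x_1^{-1}x_5A^{(5)}_{a,b,c}$ for all $a,b,c$. Put $\delta=-x_1x_5^{-1}-x_1^{-1}x_5$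 and $w=-x_1^2x_5^{-1}$. A state is a map $s$ from crossings of $D$ to $\{A^{(5)},B^{(5)}\}$; $k_s$ is the number of circles after replacing each crossing with $s(c)=A^{(5)}$ by its orientation-respecting smoothing and each crossing with $s(c)=B^{(5)}$ by the other smoothing. With $p,n$ the numbers of positive and negative crossings, $\beta^{(A^{(5)},B^{(5)})}_{X_2}(D,C)=w^{n-p}\sum_s\delta^{k_s}\prod_c s(c)(\mathrm{cl}_C(c))^{\mathrm{sign}(c)}$, and $\Phi^{(A^{(5)},B^{(5)})}_{X_2}(L)=\sum_{C\in\mathrm{Col}_{X_2}(D)}u^{\beta^{(A^{(5)},B^{(5)})}_{X_2}(D,C)}$, a formal sum (equivalently, the multiset of values $\beta$), which is independent of the diagram $D$ of $L$. *)

theory Defs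
  imports "HOL-Analysis.Analysis" "HOL-Library.Poly_Mapping" "HOL-Library.Z2"
    "HOL-Library.Multiset" "HOL-Library.FuncSet"
begin

section \<open>Oriented links in three-space\<close>

text \<open>
  Three-space is \<^typ>\<open>complex \<times> real\<close>: the first factor is the plane of the diagrams, seen from
  above, and the second factor is the height. An oriented link is given by listing its components
  as closed curves, each oriented by its parametrisation.
\<close>

type_synonym space = "complex \<times> real"

definition oriented_link :: "(real \<Rightarrow> space) list \<Rightarrow> bool" where
  "oriented_link L \<longleftrightarrow>
     (\<forall>g\<in>set L. simple_path g \<and> pathfinish g = pathstart g) \<and>
     (\<forall>i<length L. \<forall>j<length L. i \<noteq> j \<longrightarrow> path_image (L ! i) \<inter> path_image (L ! j) = {})"

text \<open>Equality of oriented closed curves: up to the choice of base point and an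
  orientation-preserving reparametrisation.\<close>

definition same_oriented_loop :: "(real \<Rightarrow> space) \<Rightarrow> (real \<Rightarrow> space) \<Rightarrow> bool" where
  "same_oriented_loop g h \<longleftrightarrow>
     (\<exists>a\<in>{0..1}. \<exists>\<phi>::real \<Rightarrow> real.
        continuous_on {0..1} \<phi> \<and> strict_mono_on {0..1} \<phi> \<and> \<phi> ` {0..1} = {0..1} \<and>
        (\<forall>t\<in>{0..1}. h t = shiftpath a g (\<phi> t)))"

definition ambient_isotopy :: "(real \<Rightarrow> space \<Rightarrow> space) \<Rightarrow> bool" where
  "ambient_isotopy H \<longleftrightarrow>
     continuous_on ({0..1} \<times> UNIV) (\<lambda>(t, x). H t x) \<and> H 0 = id \<and>
     (\<forall>t\<in>{0..1}. \<exists>g. homeomorphism UNIV UNIV (H t) g)"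

definition link_isotopic :: "(real \<Rightarrow> space) list \<Rightarrow> (real \<Rightarrow> space) list \<Rightarrow> bool" where
  "link_isotopic L M \<longleftrightarrow>
     (\<exists>H M'. ambient_isotopy H \<and> mset M' = mset M \<and>
        list_all2 (\<lambda>g h. same_oriented_loop (H 1 \<circ> g) h) L M')"


section \<open>Diagrams\<close>

text \<open>
  A diagram is the vertical projection of a polygonal link in general position, with the
  over/under information read off from the heights. It is recorded by that polygonal link: the
  list of the cyclic vertex lists of its components, each traversed in the direction of its
  orientation. Edge \<open>(i, j)\<close> is the edge that leaves vertex \<open>j\<close> of component \<open>i\<close>.
\<close>

type_synonym diagram = "space list list"
type_synonym edge = "nat \<times> nat"

definition edges :: "diagram \<Rightarrow> edge set" where
  "edges D = {(i, j). i < length D \<and> j < length (D ! i)}"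

definition next_edge :: "diagram \<Rightarrow> edge \<Rightarrow> edge" where
  "next_edge D = (\<lambda>(i, j). (i, Suc j mod length (D ! i)))"

definition adjacent :: "diagram \<Rightarrow> edge \<Rightarrow> edge \<Rightarrow> bool" where
  "adjacent D e f \<longleftrightarrow> f = next_edge D e \<or> e = next_edge D f"

definition source :: "diagram \<Rightarrow> edge \<Rightarrow> space" where
  "source D = (\<lambda>(i, j). D ! i ! j)"

definition target :: "diagram \<Rightarrow> edge \<Rightarrow> space" where
  "target D e = source D (next_edge D e)"

definition space_edge :: "diagram \<Rightarrow> edge \<Rightarrow> space set" where
  "space_edge D e = closed_segment (source D e) (target D e)"

definition plane_edge :: "diagram \<Rightarrow> edge \<Rightarrow> complex set" where
  "plane_edge D e = closed_segment (fst (source D e)) (fst (target D e))"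

definition open_plane_edge :: "diagram \<Rightarrow> edge \<Rightarrow> complex set" where
  "open_plane_edge D e = open_segment (fst (source D e)) (fst (target D e))"

text \<open>
  General position: apart from the common vertices of consecutive edges, projected edges only
  meet in points interior to exactly two edges. Such an intersection is automatically transverse,
  since overlapping collinear segments share an endpoint of one of them.
\<close>

definition regular_diagram :: "diagram \<Rightarrow> bool" where
  "regular_diagram D \<longleftrightarrow>
     (\<forall>vs\<in>set D. length vs \<ge> 3) \<and>
     (\<forall>e\<in>edges D. fst (source D e) \<noteq> fst (target D e)) \<and>
     (\<forall>e\<in>edges D. plane_edge D e \<inter> plane_edge D (next_edge D e) = {fst (target D e)}) \<and>
     (\<forall>e\<in>edges D. \<forall>f\<in>edges D. e \<noteq> f \<and> \<not> adjacent D e f \<longrightarrow>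
        plane_edge D e \<inter> plane_edge D f \<subseteq> open_plane_edge D e \<inter> open_plane_edge D f \<and>
        space_edge D e \<inter> space_edge D f = {}) \<and>
     (\<forall>e\<in>edges D. \<forall>f\<in>edges D. \<forall>g\<in>edges D. e \<noteq> f \<and> e \<noteq> g \<and> f \<noteq> g \<longrightarrow>
        plane_edge D e \<inter> plane_edge D f \<inter> plane_edge D g = {})"

fun polygonal_path :: "space list \<Rightarrow> real \<Rightarrow> space" where
  "polygonal_path (u # v # w # vs) = linepath u v +++ polygonal_path (v # w # vs)"
| "polygonal_path [u, v] = linepath u v"
| "polygonal_path _ = (\<lambda>_. 0)"

definition link_of :: "diagram \<Rightarrow> (real \<Rightarrow> space) list" where
  "link_of D = map (\<lambda>vs. polygonal_path (vs @ [hd vs])) D"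

definition is_diagram_of :: "diagram \<Rightarrow> (real \<Rightarrow> space) list \<Rightarrow> bool" where
  "is_diagram_of D L \<longleftrightarrow> regular_diagram D \<and> link_isotopic L (link_of D)"

definition shadow :: "diagram \<Rightarrow> complex set" where
  "shadow D = (\<Union>e\<in>edges D. plane_edge D e)"

definition regions :: "diagram \<Rightarrow> complex set set" where
  "regions D = components (- shadow D)"


subsection \<open>Crossings\<close>

text \<open>A crossing is the pair of its over-edge and its under-edge.\<close>

type_synonym crossing = "edge \<times> edge"

definition crossings :: "diagram \<Rightarrow> crossing set" where
  "crossings D = {(e, f). e \<in> edges D \<and> f \<in> edges D \<and> e \<noteq> f \<and>
     (\<exists>z h k. (z, h) \<in> space_edge D e \<and> (z, k) \<in> space_edge D f \<and> h > k)}"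

definition crossing_point :: "diagram \<Rightarrow> crossing \<Rightarrow> complex" where
  "crossing_point D c = (THE z. z \<in> plane_edge D (fst c) \<and> z \<in> plane_edge D (snd c))"

definition edge_dir :: "diagram \<Rightarrow> edge \<Rightarrow> complex" where
  "edge_dir D e = sgn (fst (target D e) - fst (source D e))"

definition over_dir :: "diagram \<Rightarrow> crossing \<Rightarrow> complex" where
  "over_dir D c = edge_dir D (fst c)"

definition under_dir :: "diagram \<Rightarrow> crossing \<Rightarrow> complex" where
  "under_dir D c = edge_dir D (snd c)"

text \<open>\<^term>\<open>Im (cnj a * b)\<close> is the determinant of \<open>(a, b)\<close>: it is positive iff \<open>b\<close> is reached from
  \<open>a\<close> by a counterclockwise turn of less than half a circle.\<close>

definition positive :: "diagram \<Rightarrow> crossing \<Rightarrow> bool" where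
  "positive D c \<longleftrightarrow> Im (cnj (over_dir D c) * under_dir D c) > 0"

definition crossing_sign :: "diagram \<Rightarrow> crossing \<Rightarrow> int" where
  "crossing_sign D c = (if positive D c then 1 else - 1)"

definition num_pos :: "diagram \<Rightarrow> nat" where
  "num_pos D = card {c \<in> crossings D. positive D c}"

definition num_neg :: "diagram \<Rightarrow> nat" where
  "num_neg D = card {c \<in> crossings D. \<not> positive D c}"

text \<open>
  The four regions at a crossing. Rotate it so that both strands point downward, and let
  \<open>a\<close> and \<open>b\<close> be the directions of the strands leaving to the lower left and to the lower right.
  Then \<open>b\<close> is counterclockwise from \<open>a\<close>, and the bottom, right, top and left regions lie in the
  directions \<open>a + b\<close>, \<open>b - a\<close>, \<open>- (a + b)\<close> and \<open>a - b\<close>.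
\<close>

definition region_towards :: "diagram \<Rightarrow> crossing \<Rightarrow> complex \<Rightarrow> complex set" where
  "region_towards D c v = (THE r. r \<in> regions D \<and>
     (\<forall>\<^sub>F \<epsilon> in at_right 0. crossing_point D c + complex_of_real \<epsilon> * v \<in> r))"

definition left_strand :: "diagram \<Rightarrow> crossing \<Rightarrow> complex" where
  "left_strand D c = (if positive D c then over_dir D c else under_dir D c)"

definition right_strand :: "diagram \<Rightarrow> crossing \<Rightarrow> complex" where
  "right_strand D c = (if positive D c then under_dir D c else over_dir D c)"

definition region_S :: "diagram \<Rightarrow> crossing \<Rightarrow> complex set" where
  "region_S D c = region_towards D c (left_strand D c + right_strand D c)"

definition region_E :: "diagram \<Rightarrow> crossing \<Rightarrow> complex set" where
  "region_E D c = region_towards D c (right_strand D c - left_strand D c)"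

definition region_N :: "diagram \<Rightarrow> crossing \<Rightarrow> complex set" where
  "region_N D c = region_towards D c (- (left_strand D c + right_strand D c))"

definition region_W :: "diagram \<Rightarrow> crossing \<Rightarrow> complex set" where
  "region_W D c = region_towards D c (left_strand D c - right_strand D c)"


subsection \<open>Smoothings\<close>

text \<open>
  A smoothing at a crossing replaces the part of the diagram in the open disc of radius \<open>\<epsilon>\<close> around
  the crossing by two disjoint chords, \<open>chords c \<epsilon>\<close>. The number of circles is the number of
  connected components of the result for all sufficiently small \<open>\<epsilon>\<close>.
\<close>

definition smoothed :: "diagram \<Rightarrow> (crossing \<Rightarrow> real \<Rightarrow> complex set) \<Rightarrow> real \<Rightarrow> complex set" where
  "smoothed D chords \<epsilon> =
     (shadow D - (\<Union>c\<in>crossings D. ball (crossing_point D c) \<epsilon>)) \<union> (\<Union>c\<in>crossings D. chords c \<epsilon>)"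

definition num_circles :: "diagram \<Rightarrow> (crossing \<Rightarrow> real \<Rightarrow> complex set) \<Rightarrow> nat" where
  "num_circles D chords =
     (THE k. \<forall>\<^sub>F \<epsilon> in at_right 0. card (components (smoothed D chords \<epsilon>)) = k)"

definition chord :: "complex \<Rightarrow> real \<Rightarrow> complex \<Rightarrow> complex \<Rightarrow> complex set" where
  "chord z \<epsilon> v v' = closed_segment (z + complex_of_real \<epsilon> * v) (z + complex_of_real \<epsilon> * v')"

text \<open>The orientation-respecting smoothing joins each incoming end to the outgoing end of the
  other strand.\<close>

definition oriented_smoothing :: "diagram \<Rightarrow> crossing \<Rightarrow> real \<Rightarrow> complex set" where
  "oriented_smoothing D c \<epsilon> =
     chord (crossing_point D c) \<epsilon> (- over_dir D c) (under_dir D c) \<union>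
     chord (crossing_point D c) \<epsilon> (- under_dir D c) (over_dir D c)"

definition unoriented_smoothing :: "diagram \<Rightarrow> crossing \<Rightarrow> real \<Rightarrow> complex set" where
  "unoriented_smoothing D c \<epsilon> =
     chord (crossing_point D c) \<epsilon> (- over_dir D c) (- under_dir D c) \<union>
     chord (crossing_point D c) \<epsilon> (over_dir D c) (under_dir D c)"


section \<open>Integer powers of units\<close>

definition unit_inverse :: "'a::comm_ring_1 \<Rightarrow> 'a" where
  "unit_inverse x = (THE y. x * y = 1)"

definition unit_power :: "'a::comm_ring_1 \<Rightarrow> int \<Rightarrow> 'a" where
  "unit_power x k = (if k \<ge> 0 then x ^ nat k else unit_inverse x ^ nat (- k))"


section \<open>The Jones polynomial\<close>

text \<open>
  Integer Laurent polynomials in (fractional powers of) \<open>t\<close>; \<open>t_power r\<close> is the monomial with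
  exponent \<open>r\<close>.
\<close>

type_synonym t_laurent = "rat \<Rightarrow>\<^sub>0 int"

definition t_power :: "rat \<Rightarrow> t_laurent" where
  "t_power r = Poly_Mapping.single r 1"

text \<open>
  Kauffman's smoothings, which do not depend on the orientation: turning the over-strand
  counterclockwise about the crossing, it sweeps out two opposite regions until it reaches the
  under-strand; the \<open>A\<close>-smoothing joins these two regions, the \<open>B\<close>-smoothing the other two.
  Here \<open>swept_dir\<close> is the under-strand direction reached by the over-strand direction.
\<close>

definition swept_dir :: "diagram \<Rightarrow> crossing \<Rightarrow> complex" where
  "swept_dir D c =
     (if Im (cnj (over_dir D c) * under_dir D c) > 0 then under_dir D c else - under_dir D c)"

definition A_smoothing :: "diagram \<Rightarrow> crossing \<Rightarrow> real \<Rightarrow> complex set" where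
  "A_smoothing D c \<epsilon> =
     chord (crossing_point D c) \<epsilon> (swept_dir D c) (- over_dir D c) \<union>
     chord (crossing_point D c) \<epsilon> (- swept_dir D c) (over_dir D c)"

definition B_smoothing :: "diagram \<Rightarrow> crossing \<Rightarrow> real \<Rightarrow> complex set" where
  "B_smoothing D c \<epsilon> =
     chord (crossing_point D c) \<epsilon> (swept_dir D c) (over_dir D c) \<union>
     chord (crossing_point D c) \<epsilon> (- swept_dir D c) (- over_dir D c)"

definition kauffman_A :: t_laurent where
  "kauffman_A = t_power (- (1/4))"

text \<open>The bracket is normalised to be \<open>1\<close> on the empty diagram, so that the diagram of the trivial
  knot without crossings has bracket \<open>- A\<^sup>2 - A\<^sup>-\<^sup>2\<close>. A state is given by the set of the crossings
  at which it chooses the \<open>A\<close>-smoothing.\<close>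

definition kauffman_bracket :: "diagram \<Rightarrow> t_laurent" where
  "kauffman_bracket D =
     (\<Sum>s\<in>Pow (crossings D).
        kauffman_A ^ card s * unit_inverse kauffman_A ^ card (crossings D - s) *
        (- kauffman_A\<^sup>2 - (unit_inverse kauffman_A)\<^sup>2) ^
          num_circles D (\<lambda>c. if c \<in> s then A_smoothing D c else B_smoothing D c))"

text \<open>The Jones polynomial (Kauffman's construction with \<open>A = t\<^sup>-\<^sup>1\<^sup>/\<^sup>4\<close>) of the link presented by a
  diagram, normalised to \<open>- t\<^sup>1\<^sup>/\<^sup>2 - t\<^sup>-\<^sup>1\<^sup>/\<^sup>2\<close> on the trivial knot.\<close>

definition jones :: "diagram \<Rightarrow> t_laurent" where
  "jones D = unit_power (- (kauffman_A ^ 3)) (int (num_neg D) - int (num_pos D)) * kauffman_bracket D"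


section \<open>The invariant\<close>

text \<open>Integer Laurent polynomials in five variables: finitely supported functions on the group of
  exponent vectors. As an index, the numeral \<open>5\<close> denotes the same element of
  type \<^typ>\<open>5\<close> as \<open>0\<close>.\<close>

type_synonym laurent5 = "(int ^ 5) \<Rightarrow>\<^sub>0 int"

definition xvar :: "5 \<Rightarrow> laurent5" where
  "xvar i = Poly_Mapping.single (axis i 1) 1"

definition A5 :: "bit \<times> bit \<times> bit \<Rightarrow> laurent5" where
  "A5 p =
     (if p = (0, 0, 1) then xvar 2
      else if p = (0, 1, 0) then xvar 3
      else if p = (1, 0, 1) then xvar 4
      else if p = (1, 1, 0) then xvar 2 * xvar 3 * unit_inverse (xvar 4)
      else xvar 1)"

definition B5 :: "bit \<times> bit \<times> bit \<Rightarrow> laurent5" where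
  "B5 p = unit_inverse (xvar 1) * xvar 5 * A5 p"

definition delta5 :: laurent5 where
  "delta5 = - (xvar 1 * unit_inverse (xvar 5)) - unit_inverse (xvar 1) * xvar 5"

definition w5 :: laurent5 where
  "w5 = - ((xvar 1)\<^sup>2 * unit_inverse (xvar 5))"

definition bracket_op :: "bit \<times> bit \<times> bit \<Rightarrow> bit" where
  "bracket_op = (\<lambda>(a, b, c). a + b - c)"

definition crossing_colors :: "diagram \<Rightarrow> (complex set \<Rightarrow> bit) \<Rightarrow> crossing \<Rightarrow> bit \<times> bit \<times> bit" where
  "crossing_colors D C c =
     (if positive D c then (C (region_W D c), C (region_N D c), C (region_S D c))
      else (C (region_W D c), C (region_S D c), C (region_N D c)))"

definition colorings :: "diagram \<Rightarrow> (complex set \<Rightarrow> bit) set" where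
  "colorings D = {C \<in> regions D \<rightarrow>\<^sub>E UNIV.
     \<forall>c\<in>crossings D. C (region_E D c) = bracket_op (crossing_colors D C c)}"

definition state_circles ::
    "diagram \<Rightarrow> (crossing \<Rightarrow> bit \<times> bit \<times> bit \<Rightarrow> laurent5) \<Rightarrow> nat" where
  "state_circles D s =
     num_circles D (\<lambda>c. if s c = A5 then oriented_smoothing D c else unoriented_smoothing D c)"

definition beta :: "diagram \<Rightarrow> (complex set \<Rightarrow> bit) \<Rightarrow> laurent5" where
  "beta D C =
     unit_power w5 (int (num_neg D) - int (num_pos D)) *
     (\<Sum>s \<in> crossings D \<rightarrow>\<^sub>E {A5, B5}.
        delta5 ^ state_circles D s *
        (\<Prod>c\<in>crossings D. unit_power (s c (crossing_colors D C c)) (crossing_sign D c)))"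

text \<open>The formal sum of the \<open>u\<^sup>\<beta>\<close> is the multiset of the values \<open>\<beta>\<close>.\<close>

definition Phi :: "diagram \<Rightarrow> laurent5 multiset" where
  "Phi D = image_mset (beta D) (mset_set (colorings D))"

end

theory Submission
  imports Defs
begin

text \<open>The specialisation \<open>x\<^sub>1, x\<^sub>2, x\<^sub>3, x\<^sub>4 \<mapsto> 1\<close>, \<open>x\<^sub>5 \<mapsto> t\<^sup>1\<^sup>/\<^sup>2\<close> maps every value of \<open>A\<^sup>(\<^sup>5\<^sup>)\<close> to \<open>1\<close>, and so
  it sends \<open>\<beta>(D, C)\<close> to the Jones polynomial whatever the coloring \<open>C\<close> is. Since constant maps are
  colorings, and colorings are finite in number because a diagram has finitely many regions, the
  multiset of the values \<open>\<beta>\<close> is nonempty, and any of its elements determines the Jones polynomial.\<close>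


section \<open>Finiteness of the set of regions\<close>

text \<open>A component is determined by the sides of the hyperplanes on which one of its points lies.\<close>

lemma finite_components_compl_hyperplane_pieces:
  fixes T :: "'i \<Rightarrow> 'a::euclidean_space set"
  assumes fin: "finite I"
    and closed: "\<And>i. i \<in> I \<Longrightarrow> closed (T i)"
    and normal: "\<And>i. i \<in> I \<Longrightarrow> n i \<noteq> 0"
    and sub: "\<And>i. i \<in> I \<Longrightarrow> T i \<subseteq> {x. n i \<bullet> x = b i}"
  shows "finite (components (- (\<Union>i\<in>I. T i)))"
proof -
  define U where "U = - (\<Union>i\<in>I. T i)"
  have "open U"
    unfolding U_def using fin closed by (auto intro: closed_UN)
  \<comment> \<open>A finite union of hyperplanes is negligible, whereas a nonempty open set is
    not.\<close>
  have "\<exists>x\<in>r. \<forall>i\<in>I. n i \<bullet> x \<noteq> b i" if r: "r \<in> components U" for r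
  proof (rule ccontr)
    assume "\<not> ?thesis"
    then have "r \<subseteq> (\<Union>i\<in>I. {x. n i \<bullet> x = b i})" by auto
    moreover have "negligible (\<Union>i\<in>I. {x. n i \<bullet> x = b i})"
      using fin normal by (intro negligible_Union) (auto intro: negligible_hyperplane)
    ultimately have "negligible r" by (rule negligible_subset[rotated])
    moreover have "open r" "r \<noteq> {}"
      using \<open>open U\<close> r open_components in_components_nonempty by blast+
    ultimately show False using open_not_negligible by blast
  qed
  then have "\<forall>r\<in>components U. \<exists>x. x \<in> r \<and> (\<forall>i\<in>I. n i \<bullet> x \<noteq> b i)"
    by blast
  from bchoice[OF this] obtain p
    where "\<forall>r\<in>components U. p r \<in> r \<and> (\<forall>i\<in>I. n i \<bullet> p r \<noteq> b i)" ..
  then have p: "p r \<in> r" "\<And>i. i \<in> I \<Longrightarrow> n i \<bullet> p r \<noteq> b i" if "r \<in> components U" for r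
    using that by blast+
  \<comment> \<open>The chosen points lie on no hyperplane, so one boolean per index records the
    side; \<open>restrict\<close> confines the values of \<open>side\<close> to a finite
    set.\<close>
  define side where "side r = restrict (\<lambda>i. n i \<bullet> p r < b i) I" for r
  have "inj_on side (components U)"
  proof (rule inj_onI)
    fix r r' assume r: "r \<in> components U" and r': "r' \<in> components U" and eq: "side r = side r'"
    \<comment> \<open>Open half-spaces are convex: the segment stays on one side of each hyperplane
      and therefore misses every \<open>T i\<close>.\<close>
    have "closed_segment (p r) (p r') \<subseteq> U"
    proof -
      have "x \<notin> T i" if x: "x \<in> closed_segment (p r) (p r')" and i: "i \<in> I" for x i
      proof -
        have same: "n i \<bullet> p r < b i \<longleftrightarrow> n i \<bullet> p r' < b i"
          using fun_cong[OF eq, of i] i by (simp add: side_def)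
        have "n i \<bullet> x \<noteq> b i"
        proof (cases "n i \<bullet> p r < b i")
          case True
          then have "closed_segment (p r) (p r') \<subseteq> {x. n i \<bullet> x < b i}"
            using same by (intro closed_segment_subset convex_halfspace_lt) auto
          then show ?thesis using x by auto
        next
          case False
          then have "closed_segment (p r) (p r') \<subseteq> {x. n i \<bullet> x > b i}"
            using same p(2)[OF r i] p(2)[OF r' i]
            by (intro closed_segment_subset convex_halfspace_gt) auto
          then show ?thesis using x by auto
        qed
        then show ?thesis using sub[OF i] by blast
      qed
      then show ?thesis by (auto simp: U_def)
    qed
    moreover have "connected (closed_segment (p r) (p r'))" by simp
    moreover have "r \<inter> closed_segment (p r) (p r') \<noteq> {}" using p(1)[OF r] by auto
    ultimately have "closed_segment (p r) (p r') \<subseteq> r"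
      using r components_maximal by blast
    then have "p r' \<in> r \<inter> r'" using p(1)[OF r'] by auto
    then show "r = r'" using components_nonoverlap r r' by fastforce
  qed
  moreover have "side ` components U \<subseteq> I \<rightarrow>\<^sub>E UNIV" by (auto simp: side_def)
  moreover have "finite (I \<rightarrow>\<^sub>E (UNIV :: bool set))" using fin by (simp add: finite_PiE)
  ultimately show ?thesis unfolding U_def[symmetric] using finite_imageD finite_subset by blast
qed

text \<open>In dimension at least 2 some nonzero vector is orthogonal to \<open>b - a\<close>, even
  when \<open>a = b\<close>; it serves as the normal.\<close>

lemma closed_segment_subset_line:
  fixes a b :: "'a::euclidean_space"
  assumes "2 \<le> DIM('a)"
  obtains n where "n \<noteq> 0" "closed_segment a b \<subseteq> {x. n \<bullet> x = n \<bullet> a}"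
proof -
  obtain n where n: "n \<noteq> 0" "orthogonal (b - a) n"
    using orthogonal_to_vector_exists[OF assms, of "b - a"] by blast
  have "closed_segment a b \<subseteq> {x. n \<bullet> x = n \<bullet> a}"
    using n(2)
    by (intro closed_segment_subset convex_hyperplane)
       (auto simp: orthogonal_def inner_commute[of n] inner_diff_left)
  with n(1) show ?thesis by (rule that)
qed

section \<open>Finiteness of edges, crossings, regions and colorings\<close>

lemma finite_edges: "finite (edges D)"
proof -
  have "edges D = (SIGMA i:{..<length D}. {..<length (D ! i)})"
    by (auto simp: edges_def)
  then show ?thesis by simp
qed

lemma finite_crossings: "finite (crossings D)"
  by (rule finite_subset[of _ "edges D \<times> edges D"]) (auto simp: crossings_def finite_edges)

lemma finite_regions: "finite (regions D)"
proof -
  have "\<exists>n. n \<noteq> 0 \<and> plane_edge D e \<subseteq> {x. n \<bullet> x = n \<bullet> fst (source D e)}" for e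
    unfolding plane_edge_def using closed_segment_subset_line[where 'a=complex] by (metis DIM_complex order_refl)
  then obtain n where
    "n e \<noteq> 0" "plane_edge D e \<subseteq> {x. n e \<bullet> x = n e \<bullet> fst (source D e)}" for e
    by metis
  then show ?thesis
    unfolding regions_def shadow_def
    by (intro finite_components_compl_hyperplane_pieces[where n = n
          and b = "\<lambda>e. n e \<bullet> fst (source D e)"])
       (auto simp: finite_edges plane_edge_def)
qed

lemma finite_colorings: "finite (colorings D)"
proof -
  have "(UNIV :: bit set) = {0, 1}" by auto
  then have "finite (regions D \<rightarrow>\<^sub>E (UNIV :: bit set))"
    by (metis finite.emptyI finite.insertI finite_PiE finite_regions)
  then show ?thesis by (rule rev_finite_subset) (auto simp: colorings_def)
qed

text \<open>The constant \<open>undefined\<close> lies in \<^term>\<open>R \<rightarrow>\<^sub>E UNIV\<close> for every \<open>R\<close>, so it need not be known that the four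
  regions at a crossing are regions.\<close>

lemma undefined_in_colorings: "(\<lambda>_. undefined) \<in> colorings D"
  by (auto simp: colorings_def crossing_colors_def bracket_op_def)


section \<open>Powers of units\<close>

lemma unit_inverse_eqI:
  assumes "x * y = 1"
  shows "unit_inverse x = y"
  unfolding unit_inverse_def
proof (rule the_equality)
  fix z assume "x * z = 1"
  then show "z = y" using assms by (metis mult.commute mult.left_commute mult_1_right)
qed (rule assms)

lemma unit_inverse_1: "unit_inverse 1 = 1"
  by (simp add: unit_inverse_eqI)

lemma unit_power_1: "unit_power x 1 = x"
  by (simp add: unit_power_def)

lemma unit_power_minus_1: "unit_power x (- 1) = unit_inverse x"
  by (simp add: unit_power_def)

text \<open>Cancelling powers of \<open>x * y = 1\<close> reduces both cases to a single power of
  \<open>x\<close> or of \<open>y\<close>.\<close>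

lemma unit_power_diff:
  assumes "x * y = 1"
  shows "unit_power x (int m - int n) = x ^ m * y ^ n"
proof (cases "n \<le> m")
  case True
  then obtain k where m: "m = n + k" by (rule less_eqE)
  have "x ^ m * y ^ n = x ^ k * (x * y) ^ n"
    by (simp only: m power_add power_mult_distrib ac_simps)
  then show ?thesis by (simp add: unit_power_def assms m)
next
  case False
  \<comment> \<open>Since \<open>k\<close> is nonzero the exponent is strictly negative, which
    selects the inverse branch of \<open>unit_power\<close>.\<close>
  then obtain k where n: "n = m + k" "k \<noteq> 0" by (metis less_eqE nat_le_linear add_0_right)
  have "x ^ m * y ^ n = (x * y) ^ m * y ^ k"
    by (simp only: n power_add power_mult_distrib ac_simps)
  then show ?thesis using \<open>k \<noteq> 0\<close> by (simp add: unit_power_def assms n unit_inverse_eqI[OF assms])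
qed

text \<open>Distributes the global writhe factor over the crossings, so that the two state sums can
  be compared one crossing at a time.\<close>

lemma unit_power_writhe:
  assumes "x * y = 1"
  shows "unit_power x (int (num_neg D) - int (num_pos D)) =
    (\<Prod>c\<in>crossings D. if positive D c then y else x)"
proof -
  have "crossings D \<inter> {c. positive D c} = {c \<in> crossings D. positive D c}"
    "crossings D \<inter> - {c. positive D c} = {c \<in> crossings D. \<not> positive D c}"
    by auto
  then show ?thesis
    by (simp add: unit_power_diff[OF assms] prod.If_cases[OF finite_crossings] num_neg_def
        num_pos_def mult.commute)
qed


section \<open>The specialisation homomorphism\<close>

text \<open>As an additive group, \<open>laurent5\<close> is free on the exponent vectors, so
  prescribing the images of monomials determines an additive map. Only the exponent of the fifth
  variable survives, halved.\<close>

definition specialise :: "laurent5 \<Rightarrow> t_laurent" where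
  "specialise = frag_extend (\<lambda>v. t_power (rat_of_int (v $ 5) / 2))"

lemma t_power_0: "t_power 0 = 1"
  by (simp add: t_power_def)

lemma t_power_mult: "t_power r * t_power s = t_power (r + s)"
  by (simp add: t_power_def mult_single)

lemma t_power_power: "t_power r ^ n = t_power (of_nat n * r)"
  by (induction n) (simp_all add: t_power_0 t_power_mult algebra_simps)

lemma specialise_single: "specialise (Poly_Mapping.single v 1) = t_power (rat_of_int (v $ 5) / 2)"
  by (simp add: specialise_def)

lemma specialise_diff: "specialise (p - q) = specialise p - specialise q"
  by (simp add: specialise_def frag_extend_diff)

lemma specialise_uminus: "specialise (- p) = - specialise p"
  by (simp add: specialise_def frag_extend_minus)

lemma specialise_sum: "finite I \<Longrightarrow> specialise (\<Sum>i\<in>I. f i) = (\<Sum>i\<in>I. specialise (f i))"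
  by (simp add: specialise_def frag_extend_sum)

lemma specialise_1: "specialise 1 = 1"
  by (simp add: specialise_single t_power_0 flip: single_one)

text \<open>Both sides are additive in each argument, which leaves monomials, where exponent vectors
  add.\<close>

lemma specialise_mult: "specialise (p * q) = specialise p * specialise q"
proof (induction p rule: frag_induction[OF subset_UNIV])
  case (2 v)
  show ?case
  proof (induction q rule: frag_induction[OF subset_UNIV])
    case (2 u)
    show ?case
      by (simp add: mult_single specialise_single t_power_mult add_divide_distrib)
  qed (simp_all add: specialise_diff right_diff_distrib, simp add: specialise_def)
qed (simp_all add: specialise_diff left_diff_distrib, simp add: specialise_def)

lemma specialise_power: "specialise (p ^ n) = specialise p ^ n"
  by (induction n) (simp_all add: specialise_1 specialise_mult)

lemma specialise_prod: "specialise (\<Prod>i\<in>I. f i) = (\<Prod>i\<in>I. specialise (f i))"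
  by (induction I rule: infinite_finite_induct) (simp_all add: specialise_1 specialise_mult)

text \<open>\<open>unit_inverse\<close> is a definite description: a genuine inverse of
  \<open>p\<close> is required, and its image is then the inverse of the image of
  \<open>p\<close>.\<close>

lemma specialise_unit_inverse:
  assumes "p * q = 1"
  shows "specialise (unit_inverse p) = unit_inverse (specialise p)"
proof -
  have "specialise p * specialise q = 1" using assms by (metis specialise_1 specialise_mult)
  then show ?thesis using assms by (metis unit_inverse_eqI)
qed

lemma specialise_unit_power:
  assumes "p * q = 1"
  shows "specialise (unit_power p k) = unit_power (specialise p) k"
  by (simp add: unit_power_def specialise_power specialise_unit_inverse[OF assms])

lemma unit_inverse_t_power: "unit_inverse (t_power r) = t_power (- r)"
  by (rule unit_inverse_eqI) (simp add: t_power_mult t_power_0)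

section \<open>Images of the variables, the weights, \<open>delta5\<close> and
  \<open>w5\<close>\<close>

lemma xvar_mult_inverse: "xvar i * unit_inverse (xvar i) = 1"
proof -
  have "xvar i * Poly_Mapping.single (- axis i 1) 1 = 1"
    by (simp add: xvar_def mult_single)
  then show ?thesis by (metis unit_inverse_eqI)
qed

lemma specialise_xvar: "specialise (xvar i) = (if i = 5 then t_power (1/2) else 1)"
  by (simp add: xvar_def specialise_single axis_def t_power_0)

lemma specialise_inverse_xvar:
  "specialise (unit_inverse (xvar i)) = (if i = 5 then t_power (- (1/2)) else 1)"
  using specialise_unit_inverse[OF xvar_mult_inverse, of i]
  by (simp add: specialise_xvar unit_inverse_t_power unit_inverse_1)

text \<open>Allows \<open>specialise\<close> to pass through the inverse weights at negative
  crossings.\<close>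

lemma A5_unit: "\<exists>q. A5 p * q = 1"
proof -
  have "xvar 2 * xvar 3 * unit_inverse (xvar 4) *
      (unit_inverse (xvar 2) * unit_inverse (xvar 3) * xvar 4) =
    (xvar 2 * unit_inverse (xvar 2)) * (xvar 3 * unit_inverse (xvar 3)) *
      (xvar 4 * unit_inverse (xvar 4))"
    by (simp only: ac_simps)
  then have "xvar 2 * xvar 3 * unit_inverse (xvar 4) *
      (unit_inverse (xvar 2) * unit_inverse (xvar 3) * xvar 4) = 1"
    by (simp only: xvar_mult_inverse mult_1)
  moreover have "\<exists>q. xvar i * q = 1" for i
    using xvar_mult_inverse by blast
  ultimately show ?thesis by (auto simp: A5_def)
qed

lemma B5_unit: "\<exists>q. B5 p * q = 1"
proof -
  obtain q where q: "A5 p * q = 1" using A5_unit by blast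
  have "B5 p * (xvar 1 * unit_inverse (xvar 5) * q) =
    (xvar 1 * unit_inverse (xvar 1)) * (xvar 5 * unit_inverse (xvar 5)) * (A5 p * q)"
    unfolding B5_def by (simp only: ac_simps)
  then have "B5 p * (xvar 1 * unit_inverse (xvar 5) * q) = 1"
    by (simp only: q xvar_mult_inverse mult_1)
  then show ?thesis by blast
qed

lemma specialise_A5: "specialise (A5 p) = 1"
  by (simp add: A5_def specialise_mult specialise_xvar specialise_inverse_xvar)

lemma specialise_B5: "specialise (B5 p) = t_power (1/2)"
  by (simp add: B5_def specialise_mult specialise_A5 specialise_xvar specialise_inverse_xvar)

text \<open>The images 1 and t^(1/2) already differ. Distinctness ensures that each crossing has two
  choices and that the test \<open>s c = A5\<close> tells them apart.\<close>

lemma A5_neq_B5: "A5 \<noteq> B5"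
proof
  assume "A5 = B5"
  then have "(1 :: t_laurent) = t_power (1/2)" by (metis specialise_A5 specialise_B5)
  then have "Poly_Mapping.lookup (t_power 0) 0 = Poly_Mapping.lookup (t_power (1/2)) 0"
    by (simp add: t_power_0)
  then show False by (simp add: t_power_def lookup_single when_def)
qed

text \<open>The quotient of the first variable by the fifth becomes t^(-1/2), the square of
  \<open>kauffman_A\<close>, so the two loop values agree.\<close>

lemma specialise_delta5:
  "specialise delta5 = - kauffman_A\<^sup>2 - (unit_inverse kauffman_A)\<^sup>2"
  by (simp add: delta5_def specialise_diff specialise_uminus specialise_mult specialise_xvar
      specialise_inverse_xvar kauffman_A_def unit_inverse_t_power t_power_power)

lemma specialise_w5: "specialise w5 = - t_power (- (1/2))"
  by (simp add: w5_def specialise_uminus specialise_mult specialise_power specialise_xvar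
      specialise_inverse_xvar)

lemma w5_unit: "\<exists>q. w5 * q = 1"
proof -
  have "w5 * (- ((unit_inverse (xvar 1))\<^sup>2 * xvar 5)) =
    (xvar 1 * unit_inverse (xvar 1))\<^sup>2 * (xvar 5 * unit_inverse (xvar 5))"
    unfolding w5_def by (simp add: power2_eq_square ac_simps)
  then have "w5 * (- ((unit_inverse (xvar 1))\<^sup>2 * xvar 5)) = 1"
    by (simp only: xvar_mult_inverse mult_1 power_one)
  then show ?thesis by blast
qed


section \<open>Comparison of the two state sums\<close>

lemma num_circles_cong:
  assumes "\<And>c. c \<in> crossings D \<Longrightarrow> f c = g c"
  shows "num_circles D f = num_circles D g"
proof -
  have "smoothed D f = smoothed D g" using assms by (simp add: smoothed_def fun_eq_iff)
  then show ?thesis by (simp add: num_circles_def)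
qed

lemma chord_commute: "chord z \<epsilon> v v' = chord z \<epsilon> v' v"
  by (simp add: chord_def closed_segment_commute)

text \<open>\<open>swept_dir\<close> is \<open>under_dir\<close> at a positive crossing and its
  negative otherwise; comparing the ends of the chords gives the two cases.\<close>

lemma oriented_smoothing_eq:
  "oriented_smoothing D c = (if positive D c then A_smoothing D c else B_smoothing D c)"
  by (auto simp: fun_eq_iff oriented_smoothing_def A_smoothing_def B_smoothing_def swept_dir_def
      positive_def chord_commute)

lemma unoriented_smoothing_eq:
  "unoriented_smoothing D c = (if positive D c then B_smoothing D c else A_smoothing D c)"
  by (auto simp: fun_eq_iff unoriented_smoothing_def A_smoothing_def B_smoothing_def swept_dir_def
      positive_def chord_commute)

text \<open>\<open>A5\<close> stands for the oriented smoothing, which is Kauffman's A-smoothing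
  exactly at positive crossings. Hence \<open>A5\<close> is chosen where membership in
  \<open>S\<close> agrees with positivity.\<close>

definition state_of :: "diagram \<Rightarrow> crossing set \<Rightarrow> crossing \<Rightarrow> bit \<times> bit \<times> bit \<Rightarrow> laurent5" where
  "state_of D S = restrict (\<lambda>c. if c \<in> S \<longleftrightarrow> positive D c then A5 else B5) (crossings D)"

lemma bij_betw_state_of:
  "bij_betw (state_of D) (Pow (crossings D)) (crossings D \<rightarrow>\<^sub>E {A5, B5})"
\<comment> \<open>Agreement with positivity is its own inverse operation, so the same equivalence
  recovers \<open>S\<close> from the state.\<close>
proof (rule bij_betw_byWitness[where f' = "\<lambda>s. {c \<in> crossings D. s c = A5 \<longleftrightarrow> positive D c}"])
  show "\<forall>S\<in>Pow (crossings D). {c \<in> crossings D. (state_of D S c = A5) = positive D c} = S"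
    using A5_neq_B5 by (auto simp: state_of_def split: if_splits)
  show "\<forall>s\<in>crossings D \<rightarrow>\<^sub>E {A5, B5}.
      state_of D {c \<in> crossings D. (s c = A5) = positive D c} = s"
  proof (rule ballI, rule ext)
    fix s c assume s: "s \<in> crossings D \<rightarrow>\<^sub>E {A5, B5}"
    show "state_of D {c \<in> crossings D. (s c = A5) = positive D c} c = s c"
      using PiE_mem[OF s, of c] PiE_arb[OF s, of c] A5_neq_B5 by (auto simp: state_of_def)
  qed
  show "state_of D ` Pow (crossings D) \<subseteq> crossings D \<rightarrow>\<^sub>E {A5, B5}"
    by (auto simp: state_of_def)
qed auto

lemma state_circles_state_of:
  "state_circles D (state_of D S) =
    num_circles D (\<lambda>c. if c \<in> S then A_smoothing D c else B_smoothing D c)"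
  unfolding state_circles_def
  by (rule num_circles_cong)
     (use A5_neq_B5 in \<open>auto simp: state_of_def oriented_smoothing_eq unoriented_smoothing_eq\<close>)

text \<open>The color triple \<open>p\<close> disappears because \<open>A5\<close> and
  \<open>B5\<close> each have the same image at all triples; this makes the specialised invariant
  independent of the coloring.\<close>

lemma specialise_state_weight:
  assumes "c \<in> crossings D"
  shows "specialise (unit_power (state_of D S c p) (crossing_sign D c)) =
    (if c \<in> S \<longleftrightarrow> positive D c then 1
     else if positive D c then t_power (1/2) else t_power (- (1/2)))"
proof -
  have "\<exists>q. state_of D S c p * q = 1"
    using assms A5_unit B5_unit by (simp add: state_of_def)
  then have "specialise (unit_power (state_of D S c p) (crossing_sign D c)) =
    unit_power (specialise (state_of D S c p)) (crossing_sign D c)"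
    using specialise_unit_power by blast
  then show ?thesis
    using assms
    by (simp add: state_of_def crossing_sign_def specialise_A5 specialise_B5 unit_power_1
        unit_power_minus_1 unit_inverse_t_power unit_inverse_1)
qed

lemma specialise_beta: "specialise (beta D C) = jones D"
proof -
  let ?w = "int (num_neg D) - int (num_pos D)"
  let ?\<delta> = "\<lambda>S. (- kauffman_A\<^sup>2 - (unit_inverse kauffman_A)\<^sup>2) ^
    num_circles D (\<lambda>c. if c \<in> S then A_smoothing D c else B_smoothing D c)"
  let ?b = "\<lambda>S c. specialise (unit_power (state_of D S c (crossing_colors D C c)) (crossing_sign D c))"
  have wb: "unit_power (specialise w5) ?w =
      (\<Prod>c\<in>crossings D. if positive D c then - t_power (1/2) else - t_power (- (1/2)))"
    unfolding specialise_w5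
    by (rule unit_power_writhe) (simp add: t_power_mult t_power_0)
  have wj: "unit_power (- (kauffman_A ^ 3)) ?w =
      (\<Prod>c\<in>crossings D. if positive D c then - t_power (3/4) else - t_power (- (3/4)))"
  proof -
    have cube: "kauffman_A ^ 3 = t_power (- (3/4))"
      by (simp add: kauffman_A_def t_power_power)
    show ?thesis
      unfolding cube by (rule unit_power_writhe) (simp add: t_power_mult t_power_0)
  qed
  \<comment> \<open>The writhe factors and the local weights differ separately, but their products
    agree at each crossing: -t^(1/2) or -t at a positive one and -t^(-1) or -t^(-1/2) at a negative
    one, according to whether it lies in \<open>S\<close> or not.\<close>
  have weight: "unit_power (specialise w5) ?w * (\<Prod>c\<in>crossings D. ?b S c) =
      unit_power (- (kauffman_A ^ 3)) ?w *
        (kauffman_A ^ card S * unit_inverse kauffman_A ^ card (crossings D - S))"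
    if S: "S \<in> Pow (crossings D)" for S
  proof -
    have "crossings D \<inter> {c. c \<in> S} = S" "crossings D \<inter> - {c. c \<in> S} = crossings D - S"
      using S by auto
    then have "kauffman_A ^ card S * unit_inverse kauffman_A ^ card (crossings D - S) =
      (\<Prod>c\<in>crossings D. if c \<in> S then t_power (- (1/4)) else t_power (1/4))"
      by (simp add: prod.If_cases[OF finite_crossings] kauffman_A_def unit_inverse_t_power)
    then show ?thesis
      unfolding wb wj
      by (auto simp: specialise_state_weight t_power_mult simp flip: prod.distrib intro!: prod.cong)
  qed
  have "specialise (beta D C) = unit_power (specialise w5) ?w *
      (\<Sum>s\<in>crossings D \<rightarrow>\<^sub>E {A5, B5}. specialise delta5 ^ state_circles D s *
        (\<Prod>c\<in>crossings D. specialise (unit_power (s c (crossing_colors D C c)) (crossing_sign D c))))"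
    using w5_unit
    by (auto simp: beta_def specialise_mult specialise_unit_power specialise_sum specialise_power
        specialise_prod finite_PiE finite_crossings)
  \<comment> \<open>Corresponding states smooth every crossing alike and thus have equally many
    circles.\<close>
  also have "\<dots> = (\<Sum>S\<in>Pow (crossings D).
      unit_power (specialise w5) ?w * (\<Prod>c\<in>crossings D. ?b S c) * ?\<delta> S)"
    by (subst sum.reindex_bij_betw[OF bij_betw_state_of, symmetric])
       (simp add: sum_distrib_left state_circles_state_of specialise_delta5 ac_simps)
  also have "\<dots> = jones D"
    unfolding jones_def kauffman_bracket_def sum_distrib_left
    by (rule sum.cong[OF refl]) (simp only: weight mult.assoc)
  finally show ?thesis .
qed

theorem theorem5p5:
  fixes L L' :: "(real \<Rightarrow> complex \<times> real) list" and D D' :: diagram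
  assumes "oriented_link L" and "oriented_link L'"
    and "is_diagram_of D L" and "is_diagram_of D' L'"
    and "Phi D = Phi D'"
  shows "jones D = jones D'"
proof -
  \<comment> \<open>Finiteness matters here: \<open>mset_set\<close> of an infinite set is
    empty.\<close>
  have "beta D (\<lambda>_. undefined) \<in># Phi D"
    by (simp add: Phi_def finite_colorings undefined_in_colorings)
  then obtain C where "beta D (\<lambda>_. undefined) = beta D' C"
    unfolding assms(5) by (auto simp: Phi_def)
  then show ?thesis by (metis specialise_beta)
qed

end
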